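(* Let $\varphi:G\times M\to M$ be a continuous left action of a topological group $G$ on a metric space $(M,d)$, and let $X\subset M$ be a non-empty compact subset. Then $d_X:G/H_X\times G/H_X\to\mathbb R$ is continuous with respect to the quotient topology of $G/H_X$.
   Context: $H_X=\{g\in G:gX=X\}$ is the isotropy subgroup of $X$. The induced Hausdorff metric on $G/H_X$ is $d_X(g_1H_X,g_2H_X)=d_H(g_1X,g_2X)$, where $d_H(A,B)=\max\{\sup_{a\in A}d(a,B),\sup_{b\in B}d(b,A)\}$ is the Hausdorff distance between non-empty subsets of $M$. *)

theory Defs
  imports "HOL-Analysis.Analysis" "HOL-Algebra.Group_Action" "HOL-Algebra.Left_Coset"
begin

section \<open>Topological groups and continuous actions on metric spaces\<close>

text \<open>No separation axiom is imposed on the topology of the group.\<close>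

locale topological_group = group G for G (structure) +
  fixes T :: "'a topology"
  assumes topspace_eq_carrier: "topspace T = carrier G"
    and continuous_mult: "continuous_map (prod_topology T T) T (\<lambda>(g, h). g \<otimes> h)"
    and continuous_inv: "continuous_map T T (\<lambda>g. inv g)"

text \<open>
  The action is curried, \<open>\<phi> g x\<close> being \<open>\<phi>(g, x)\<close>. By the library's convention for
  \<^locale>\<open>group_action\<close> each \<open>\<phi> g\<close> is the constant \<open>undefined\<close> outside \<open>M\<close>; continuity is joint.
\<close>

locale continuous_group_action =
  topological_group G T + Metric_space M d + group_action G M \<phi>
  for G (structure) and T and M :: "'b set" and d and \<phi> +
  assumes continuous_action:
    "continuous_map (prod_topology T (Metric_space.mtopology M d)) (Metric_space.mtopology M d)
      (\<lambda>(g, x). \<phi> g x)"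

definition isotropy :: "('a, 'm) monoid_scheme \<Rightarrow> ('a \<Rightarrow> 'b \<Rightarrow> 'b) \<Rightarrow> 'b set \<Rightarrow> 'a set"
  where "isotropy G \<phi> X = {g \<in> carrier G. \<phi> g ` X = X}"

lemma (in group_action) image_mult:
  assumes "X \<subseteq> E" "g \<in> carrier G" "h \<in> carrier G"
  shows "\<phi> (g \<otimes> h) ` X = \<phi> g ` \<phi> h ` X"
  using assms by (auto simp: image_image composition_rule subset_iff intro!: image_cong)

lemma (in group_action) isotropy_subgroup:
  assumes "X \<subseteq> E"
  shows "subgroup (isotropy G \<phi> X) G"
proof -
  interpret group G
    using group_hom group_hom.axioms(1) by auto
  have "\<phi> \<one> x = x" if "x \<in> X" for x
    using that assms fun_cong[OF id_eq_one, of x] by auto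
  then have one: "\<phi> \<one> ` X = X"
    by (metis image_cong image_ident)
  show ?thesis
  proof (rule subgroupI)
    show "isotropy G \<phi> X \<subseteq> carrier G"
      unfolding isotropy_def by blast
    show "isotropy G \<phi> X \<noteq> {}"
      unfolding isotropy_def using one one_closed by blast
  next
    fix g assume "g \<in> isotropy G \<phi> X"
    then have g: "g \<in> carrier G" and gX: "\<phi> g ` X = X"
      unfolding isotropy_def by blast+
    have "\<phi> (inv g \<otimes> g) ` X = \<phi> (inv g) ` \<phi> g ` X"
      by (rule image_mult[OF assms inv_closed[OF g] g])
    then have "\<phi> (inv g) ` X = X"
      unfolding l_inv[OF g] gX one by (rule sym)
    with g show "inv g \<in> isotropy G \<phi> X"
      unfolding isotropy_def by blast
  next
    fix g h assume "g \<in> isotropy G \<phi> X" "h \<in> isotropy G \<phi> X"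
    then have g: "g \<in> carrier G" "\<phi> g ` X = X" and h: "h \<in> carrier G" "\<phi> h ` X = X"
      unfolding isotropy_def by blast+
    have "\<phi> (g \<otimes> h) ` X = X"
      unfolding image_mult[OF assms g(1) h(1)] h(2) g(2) ..
    with g h show "g \<otimes> h \<in> isotropy G \<phi> X"
      unfolding isotropy_def by blast
  qed
qed


section \<open>The quotient topology\<close>

text \<open>The final topology on the image of \<open>p\<close>.\<close>

definition quotient_topology :: "'a topology \<Rightarrow> ('a \<Rightarrow> 'c) \<Rightarrow> 'c topology"
  where "quotient_topology T p =
    topology (\<lambda>U. U \<subseteq> p ` topspace T \<and> openin T {x \<in> topspace T. p x \<in> U})"

lemma openin_quotient_topology:
  "openin (quotient_topology T p) U \<longleftrightarrow>
    U \<subseteq> p ` topspace T \<and> openin T {x \<in> topspace T. p x \<in> U}"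
proof -
  have "istopology (\<lambda>U. U \<subseteq> p ` topspace T \<and> openin T {x \<in> topspace T. p x \<in> U})"
    unfolding istopology_def
  proof (intro conjI allI impI)
    fix A B
    assume "A \<subseteq> p ` topspace T \<and> openin T {x \<in> topspace T. p x \<in> A}"
      and "B \<subseteq> p ` topspace T \<and> openin T {x \<in> topspace T. p x \<in> B}"
    moreover have "{x \<in> topspace T. p x \<in> A \<inter> B} =
        {x \<in> topspace T. p x \<in> A} \<inter> {x \<in> topspace T. p x \<in> B}" by auto
    ultimately show "A \<inter> B \<subseteq> p ` topspace T" "openin T {x \<in> topspace T. p x \<in> A \<inter> B}"
      by auto
  next
    fix \<K>
    assume K: "\<forall>K\<in>\<K>. K \<subseteq> p ` topspace T \<and> openin T {x \<in> topspace T. p x \<in> K}"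
    then show "\<Union>\<K> \<subseteq> p ` topspace T" by auto
    have "{x \<in> topspace T. p x \<in> \<Union>\<K>} = (\<Union>K\<in>\<K>. {x \<in> topspace T. p x \<in> K})" by auto
    with K show "openin T {x \<in> topspace T. p x \<in> \<Union>\<K>}" by auto
  qed
  then show ?thesis by (simp add: quotient_topology_def topology_inverse')
qed

lemma topspace_quotient_topology [simp]: "topspace (quotient_topology T p) = p ` topspace T"
proof
  show "topspace (quotient_topology T p) \<subseteq> p ` topspace T"
    by (rule openin_quotient_topology[THEN iffD1, OF openin_topspace, THEN conjunct1])
  have "{x \<in> topspace T. p x \<in> p ` topspace T} = topspace T" by auto
  then show "p ` topspace T \<subseteq> topspace (quotient_topology T p)"
    by (intro openin_subset) (simp add: openin_quotient_topology)
qed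

lemma quotient_map_quotient_topology: "quotient_map T (quotient_topology T p) p"
  by (auto simp: quotient_map_def openin_quotient_topology)

definition coset_topology :: "('a, 'm) monoid_scheme \<Rightarrow> 'a topology \<Rightarrow> 'a set \<Rightarrow> 'a set topology"
  where "coset_topology G T H = quotient_topology T (\<lambda>g. g <#\<^bsub>G\<^esub> H)"

lemma (in topological_group) topspace_coset_topology:
  "topspace (coset_topology G T H) = lcosets H"
  by (auto simp: coset_topology_def topspace_eq_carrier LCOSETS_def)


section \<open>The Hausdorff distance and the induced distance on cosets\<close>

text \<open>
  The supremum and infimum are those of the reals, hence meaningful only when they exist; for
  nonempty bounded sets, in particular nonempty compact ones, they do.
\<close>

definition point_set_dist :: "('b \<Rightarrow> 'b \<Rightarrow> real) \<Rightarrow> 'b \<Rightarrow> 'b set \<Rightarrow> real"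
  where "point_set_dist d a B = (INF b\<in>B. d a b)"

definition hausdorff_dist :: "('b \<Rightarrow> 'b \<Rightarrow> real) \<Rightarrow> 'b set \<Rightarrow> 'b set \<Rightarrow> real"
  where "hausdorff_dist d A B =
    max (SUP a\<in>A. point_set_dist d a B) (SUP b\<in>B. point_set_dist d b A)"

lemma (in Metric_space) bdd_below_dist: "bdd_below ((\<lambda>b. d a b) ` B)"
  by (rule bdd_belowI[of _ 0]) auto

lemma (in Metric_space) bdd_above_point_set_dist:
  assumes "mbounded A" "mbounded B" "B \<noteq> {}"
  shows "bdd_above ((\<lambda>a. point_set_dist d a B) ` A)"
proof -
  obtain b where b: "b \<in> B" using assms by auto
  have "mbounded (A \<union> B)" using assms by (simp add: mbounded_Un)
  then obtain k where k: "\<And>x y. x \<in> A \<union> B \<Longrightarrow> y \<in> A \<union> B \<Longrightarrow> d x y \<le> k"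
    unfolding mbounded_alt by blast
  have "point_set_dist d a B \<le> k" if "a \<in> A" for a
    unfolding point_set_dist_def using that b k
    by (intro order_trans[OF cINF_lower[OF bdd_below_dist b]]) auto
  then show ?thesis by (intro bdd_aboveI[of _ k]) auto
qed

text \<open>The value of the Hausdorff distance on representatives; independence of their choice is
  \<open>coset_dist_l_coset\<close> below.\<close>

definition coset_dist ::
  "('a, 'm) monoid_scheme \<Rightarrow> ('b \<Rightarrow> 'b \<Rightarrow> real) \<Rightarrow> ('a \<Rightarrow> 'b \<Rightarrow> 'b) \<Rightarrow> 'b set \<Rightarrow> 'a set \<Rightarrow> 'a set \<Rightarrow> real"
  where "coset_dist G d \<phi> X C D =
    (THE r. \<exists>g\<^sub>1\<in>carrier G. \<exists>g\<^sub>2\<in>carrier G.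
      C = g\<^sub>1 <#\<^bsub>G\<^esub> isotropy G \<phi> X \<and> D = g\<^sub>2 <#\<^bsub>G\<^esub> isotropy G \<phi> X \<and>
      r = hausdorff_dist d (\<phi> g\<^sub>1 ` X) (\<phi> g\<^sub>2 ` X))"

lemma (in group_action) image_eq_if_l_coset_eq:
  assumes "X \<subseteq> E" "g \<in> carrier G" "g' \<in> carrier G"
    and eq: "g <#\<^bsub>G\<^esub> isotropy G \<phi> X = g' <#\<^bsub>G\<^esub> isotropy G \<phi> X"
  shows "\<phi> g ` X = \<phi> g' ` X"
proof -
  interpret group G
    using group_hom group_hom.axioms(1) by auto
  have "g \<in> g' <#\<^bsub>G\<^esub> isotropy G \<phi> X"
    using lcos_self[OF assms(2) isotropy_subgroup[OF assms(1)]] eq by simp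
  then obtain h where h: "h \<in> carrier G" "\<phi> h ` X = X" "g = g' \<otimes> h"
    by (auto simp: l_coset_def isotropy_def)
  have "\<phi> g ` X = \<phi> g' ` \<phi> h ` X"
    unfolding h(3) by (rule image_mult[OF assms(1,3) h(1)])
  then show ?thesis unfolding h(2) .
qed

lemma (in group_action) coset_dist_l_coset:
  assumes "X \<subseteq> E" "g\<^sub>1 \<in> carrier G" "g\<^sub>2 \<in> carrier G"
  shows "coset_dist G d \<phi> X (g\<^sub>1 <#\<^bsub>G\<^esub> isotropy G \<phi> X) (g\<^sub>2 <#\<^bsub>G\<^esub> isotropy G \<phi> X) =
    hausdorff_dist d (\<phi> g\<^sub>1 ` X) (\<phi> g\<^sub>2 ` X)"
  unfolding coset_dist_def
proof (rule the_equality)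
  fix r
  assume "\<exists>h\<^sub>1\<in>carrier G. \<exists>h\<^sub>2\<in>carrier G.
      g\<^sub>1 <#\<^bsub>G\<^esub> isotropy G \<phi> X = h\<^sub>1 <#\<^bsub>G\<^esub> isotropy G \<phi> X \<and> g\<^sub>2 <#\<^bsub>G\<^esub> isotropy G \<phi> X = h\<^sub>2 <#\<^bsub>G\<^esub> isotropy G \<phi> X \<and>
      r = hausdorff_dist d (\<phi> h\<^sub>1 ` X) (\<phi> h\<^sub>2 ` X)"
  then obtain h\<^sub>1 h\<^sub>2 where h: "h\<^sub>1 \<in> carrier G" "h\<^sub>2 \<in> carrier G"
      "g\<^sub>1 <#\<^bsub>G\<^esub> isotropy G \<phi> X = h\<^sub>1 <#\<^bsub>G\<^esub> isotropy G \<phi> X"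
      "g\<^sub>2 <#\<^bsub>G\<^esub> isotropy G \<phi> X = h\<^sub>2 <#\<^bsub>G\<^esub> isotropy G \<phi> X"
      and r: "r = hausdorff_dist d (\<phi> h\<^sub>1 ` X) (\<phi> h\<^sub>2 ` X)"
    by blast
  show "r = hausdorff_dist d (\<phi> g\<^sub>1 ` X) (\<phi> g\<^sub>2 ` X)"
    unfolding r image_eq_if_l_coset_eq[OF assms(1,2) h(1,3)]
      image_eq_if_l_coset_eq[OF assms(1,3) h(2,4)] ..
qed (use assms in blast)

end

theory Submission
  imports Defs
begin

text \<open>
  If \<open>g\<close> is close to \<open>h\<close>, then \<open>\<phi> g x\<close> is close to \<open>\<phi> h x\<close> uniformly for \<open>x\<close> in the compact set
  \<open>X\<close> (tube lemma), so \<open>\<phi> g ` X\<close> is close to \<open>\<phi> h ` X\<close> in the Hausdorff distance. A product of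
  quotient maps need not be a quotient map, so continuity in two variables is not checked on
  \<open>G \<times> G\<close>. Instead, the balls of \<open>d\<^sub>X\<close> are open in the quotient topology, and every
  pseudometric with open balls is jointly continuous by the triangle inequality.
\<close>

lemma hausdorff_dist_commute: "hausdorff_dist d A B = hausdorff_dist d B A"
  by (simp add: hausdorff_dist_def max.commute)

context Metric_space
begin

lemma point_set_dist_le:
  assumes "b \<in> B" "d a b \<le> r"
  shows "point_set_dist d a B \<le> r"
  unfolding point_set_dist_def by (rule cINF_lower2[OF bdd_below_dist assms])

text \<open>A bound on all members bounds a real supremum only over a nonempty index set, hence the
  nonemptiness hypotheses.\<close>

lemma hausdorff_dist_le:
  assumes "A \<noteq> {}" "B \<noteq> {}"
    and "\<And>a. a \<in> A \<Longrightarrow> \<exists>b\<in>B. d a b \<le> r" "\<And>b. b \<in> B \<Longrightarrow> \<exists>a\<in>A. d b a \<le> r"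
  shows "hausdorff_dist d A B \<le> r"
  unfolding hausdorff_dist_def
  by (intro max.boundedI cSUP_least) (use assms point_set_dist_le in blast)+

text \<open>Boundedness makes the supremum in \<open>hausdorff_dist\<close> a true upper bound of
  \<open>point_set_dist d a B\<close>. The infimum over \<open>B\<close> need not be attained, but
  any value strictly above it is undercut by some member.\<close>

lemma hausdorff_dist_lessD:
  assumes "mbounded A" "mbounded B" "B \<noteq> {}" "hausdorff_dist d A B < r" "a \<in> A"
  shows "\<exists>b\<in>B. d a b < r"
proof -
  have "point_set_dist d a B < r"
    using assms(4) cSUP_lessD[OF bdd_above_point_set_dist[OF assms(1-3)] _ assms(5)]
    by (simp add: hausdorff_dist_def)
  then show ?thesis
    using assms(3) bdd_below_dist by (simp add: point_set_dist_def cINF_less_iff)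
qed

text \<open>Bounded sets need not contain nearest points, so points are chosen with an arbitrary
  slack \<open>e\<close>, half of it for each of the two hops.\<close>

lemma hausdorff_dist_triangle:
  assumes "mbounded A" "mbounded B" "mbounded C" "A \<noteq> {}" "B \<noteq> {}" "C \<noteq> {}"
  shows "hausdorff_dist d A C \<le> hausdorff_dist d A B + hausdorff_dist d B C"
proof (rule field_le_epsilon)
  fix e :: real assume "0 < e"
  \<comment> \<open>General sets allow both halves of the maximum: from \<open>A\<close> through
    \<open>B\<close> to \<open>C\<close>, and back.\<close>
  have near: "\<exists>z\<in>R. d x z \<le> hausdorff_dist d P Q + hausdorff_dist d Q R + e"
    if PQR: "mbounded P" "mbounded Q" "mbounded R" "Q \<noteq> {}" "R \<noteq> {}" "x \<in> P" for P Q R x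
  proof -
    obtain y where y: "y \<in> Q" "d x y < hausdorff_dist d P Q + e/2"
      using hausdorff_dist_lessD[of P Q "hausdorff_dist d P Q + e/2" x] PQR \<open>0 < e\<close> by force
    obtain z where z: "z \<in> R" "d y z < hausdorff_dist d Q R + e/2"
      using hausdorff_dist_lessD[of Q R "hausdorff_dist d Q R + e/2" y] PQR y(1) \<open>0 < e\<close> by force
    have "d x z \<le> d x y + d y z"
      using PQR y(1) z(1) by (meson mbounded_subset_mspace subsetD triangle)
    with y(2) z show ?thesis by force
  qed
  show "hausdorff_dist d A C \<le> hausdorff_dist d A B + hausdorff_dist d B C + e"
    using near[of A B C] near[of C B A] assms
    by (intro hausdorff_dist_le) (simp_all add: hausdorff_dist_commute add.commute)
qed

end

text \<open>The axioms are asked on \<open>topspace Y\<close> only, because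
  \<open>coset_dist\<close> is controlled only on left cosets.\<close>

lemma continuous_map_pseudometric:
  fixes \<delta> :: "'c \<Rightarrow> 'c \<Rightarrow> real"
  assumes commute: "\<And>x y. x \<in> topspace Y \<Longrightarrow> y \<in> topspace Y \<Longrightarrow> \<delta> x y = \<delta> y x"
    and triangle: "\<And>x y z. x \<in> topspace Y \<Longrightarrow> y \<in> topspace Y \<Longrightarrow> z \<in> topspace Y \<Longrightarrow>
      \<delta> x z \<le> \<delta> x y + \<delta> y z"
    and refl: "\<And>x. x \<in> topspace Y \<Longrightarrow> \<delta> x x = 0"
    and ball: "\<And>x e. x \<in> topspace Y \<Longrightarrow> 0 < e \<Longrightarrow> openin Y {y \<in> topspace Y. \<delta> x y < e}"
  shows "continuous_map (prod_topology Y Y) euclideanreal (\<lambda>(x, y). \<delta> x y)"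
  unfolding mtopology_is_euclidean[symmetric] Met_TC.continuous_map_to_metric
proof (intro ballI allI impI)
  fix p and e :: real assume "p \<in> topspace (prod_topology Y Y)" "0 < e"
  then obtain x y where p: "p = (x, y)" "x \<in> topspace Y" "y \<in> topspace Y" by auto
  let ?B = "\<lambda>z. {w \<in> topspace Y. \<delta> z w < e/2}"
  \<comment> \<open>The chains x, x', y', y and x', x, y, y' bound the difference by \<delta> x x' +
    \<delta> y y'.\<close>
  have "\<bar>\<delta> x y - \<delta> x' y'\<bar> < e" if "x' \<in> ?B x" "y' \<in> ?B y" for x' y'
    using that p triangle[of x x' y] triangle[of x' y' y] triangle[of x' x y'] triangle[of x y y']
      commute[of x x'] commute[of y y'] by auto
  moreover have "openin Y (?B z)" if "z \<in> topspace Y" for z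
    using ball[OF that, of "e/2"] \<open>0 < e\<close> by simp
  ultimately show "\<exists>U. openin (prod_topology Y Y) U \<and> p \<in> U \<and>
      (\<forall>q\<in>U. (case q of (x, y) \<Rightarrow> \<delta> x y) \<in> Met_TC.mball (case p of (x, y) \<Rightarrow> \<delta> x y) e)"
    using p \<open>0 < e\<close>
    by (intro exI[of _ "?B x \<times> ?B y"]) (auto simp: openin_prod_Times_iff refl dist_real_def simp del: less_divide_eq_numeral1)
qed

context continuous_group_action
begin

lemma continuous_map_action:
  assumes "g \<in> carrier G"
  shows "continuous_map mtopology mtopology (\<phi> g)"
proof -
  have "continuous_map mtopology (prod_topology T mtopology) (\<lambda>x. (g, x))"
    using assms by (auto intro!: continuous_intros simp: topspace_eq_carrier)
  from continuous_map_compose[OF this continuous_action] show ?thesis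
    by (simp add: o_def)
qed

text \<open>This supplies the open set for the tube lemma. Both points depend continuously on the
  pair: one by the action, the other by projecting to \<open>M\<close> and applying \<phi>
  h.\<close>

lemma openin_action_dist_less:
  assumes "h \<in> carrier G"
  shows "openin (prod_topology T mtopology)
    {p \<in> topspace (prod_topology T mtopology). d (\<phi> (fst p) (snd p)) (\<phi> h (snd p)) < e}"
proof -
  have "continuous_map (prod_topology T mtopology) euclideanreal
      (\<lambda>p. mdist (metric (M, d)) (\<phi> (fst p) (snd p)) (\<phi> h (snd p)))"
    using continuous_action continuous_map_compose[OF continuous_map_snd continuous_map_action[OF assms]]
    by (intro continuous_map_mdist) (simp_all add: mtopology_of_def o_def case_prod_beta')
  from openin_continuous_map_preimage[OF this, of "{..<e}"] show ?thesis
    by simp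
qed

lemma eventually_hausdorff_dist_less:
  assumes X: "compactin mtopology X" "X \<noteq> {}" and h: "h \<in> carrier G" and "0 < e"
  obtains U where "openin T U" "h \<in> U" "\<And>g. g \<in> U \<Longrightarrow> hausdorff_dist d (\<phi> h ` X) (\<phi> g ` X) < e"
proof -
  \<comment> \<open>Half of \<open>e\<close>, since \<open>hausdorff_dist_le\<close> gives a weak
    inequality and a strict one is wanted.\<close>
  let ?W = "{p \<in> topspace (prod_topology T mtopology).
    d (\<phi> (fst p) (snd p)) (\<phi> h (snd p)) < e/2}"
  have XM: "X \<subseteq> M"
    using compactin_subset_topspace[OF X(1)] by simp
  then have hM: "\<phi> h x \<in> M" if "x \<in> X" for x
    using that element_image[OF h] by blast
  \<comment> \<open>At g = h the two points coincide, and \<open>d\<close> vanishes there because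
    the point lies in \<open>M\<close>.\<close>
  have sub: "{h} \<times> X \<subseteq> ?W"
    using h XM hM \<open>0 < e\<close> by (auto simp: topspace_eq_carrier)
  obtain U V where U: "openin T U" "h \<in> U" and UV: "X \<subseteq> V" "U \<times> V \<subseteq> ?W"
    using tube_lemma_right[OF openin_action_dist_less[OF h] X(1) _ sub] h
    unfolding topspace_eq_carrier by blast
  have "hausdorff_dist d (\<phi> h ` X) (\<phi> g ` X) < e" if "g \<in> U" for g
  proof -
    have "d (\<phi> g x) (\<phi> h x) \<le> e/2" if "x \<in> X" for x
      using UV \<open>g \<in> U\<close> that by fastforce
    \<comment> \<open>The same \<open>x\<close> pairs a point of one image with a point of the
      other, so one estimate serves both directions.\<close>
    then have "hausdorff_dist d (\<phi> h ` X) (\<phi> g ` X) \<le> e/2"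
      using X(2) commute by (intro hausdorff_dist_le) fastforce+
    with \<open>0 < e\<close> show ?thesis by simp
  qed
  with U that show thesis by blast
qed

lemma continuous_map_coset_dist:
  assumes X: "compactin mtopology X" "X \<noteq> {}"
  defines "Y \<equiv> coset_topology G T (isotropy G \<phi> X)"
  shows "continuous_map (prod_topology Y Y) euclideanreal (\<lambda>(C, D). coset_dist G d \<phi> X C D)"
proof -
  have XM: "X \<subseteq> M"
    using compactin_subset_topspace[OF X(1)] by simp
  let ?p = "\<lambda>g. g <# isotropy G \<phi> X"
  let ?D = "\<lambda>g h. hausdorff_dist d (\<phi> g ` X) (\<phi> h ` X)"
  have Y: "topspace Y = ?p ` carrier G"
    by (simp add: Y_def coset_topology_def topspace_eq_carrier)
  \<comment> \<open>This moves every later check from cosets to representatives in the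
    group.\<close>
  have dist: "coset_dist G d \<phi> X (?p g) (?p h) = ?D g h" if "g \<in> carrier G" "h \<in> carrier G" for g h
    using XM that by (rule coset_dist_l_coset)
  have bdd: "mbounded (\<phi> g ` X)" if "g \<in> carrier G" for g
    using X(1) continuous_map_action[OF that] by (intro compactin_imp_mbounded image_compactin)
  have tri: "?D g k \<le> ?D g h + ?D h k"
    if "g \<in> carrier G" "h \<in> carrier G" "k \<in> carrier G" for g h k
    using that X(2) bdd by (intro hausdorff_dist_triangle) auto
  have refl: "?D g g = 0" if "g \<in> carrier G" for g
  proof (rule antisym)
    show "?D g g \<le> 0"
      using XM X(2) that element_image[OF that]
      by (intro hausdorff_dist_le) force+
    \<comment> \<open>The triangle inequality with three equal arguments reads D \<le> D +
      D.\<close>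
    show "0 \<le> ?D g g"
      using tri[OF that that that] by simp
  qed
  have ball: "openin T {g \<in> carrier G. ?D h g < e}" if h: "h \<in> carrier G" for h e
  proof (subst openin_subopen, intro ballI)
    fix g assume g: "g \<in> {g \<in> carrier G. ?D h g < e}"
    \<comment> \<open>The radius is what the distance from \<open>h\<close> to \<open>g\<close>
      leaves of \<open>e\<close>, so the triangle inequality keeps \<open>U\<close> inside the
      ball.\<close>
    then obtain U where U: "openin T U" "g \<in> U" "\<And>k. k \<in> U \<Longrightarrow> ?D g k < e - ?D h g"
      using eventually_hausdorff_dist_less[OF X, of g "e - ?D h g"] by auto
    have "U \<subseteq> {g \<in> carrier G. ?D h g < e}"
    proof
      fix k assume "k \<in> U"
      moreover from this have "k \<in> carrier G"
        using openin_subset[OF U(1)] topspace_eq_carrier by auto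
      ultimately show "k \<in> {g \<in> carrier G. ?D h g < e}"
        using U(3)[of k] tri[of h g k] g h by auto
    qed
    with U show "\<exists>U. openin T U \<and> g \<in> U \<and> U \<subseteq> {g \<in> carrier G. ?D h g < e}"
      by blast
  qed
  show ?thesis
  proof (rule continuous_map_pseudometric)
    fix C and e :: real assume "C \<in> topspace Y"
    then obtain h where h: "h \<in> carrier G" "C = ?p h" using Y by blast
    \<comment> \<open>The preimage of a ball under the coset projection is a ball in the group, so
      its openness there is openness in the quotient.\<close>
    have "{g \<in> carrier G. ?p g \<in> {D \<in> topspace Y. coset_dist G d \<phi> X C D < e}} =
        {g \<in> carrier G. ?D h g < e}"
      using h dist Y by auto
    with ball[OF h(1)]
    have "openin T {g \<in> topspace T. ?p g \<in> {D \<in> topspace Y. coset_dist G d \<phi> X C D < e}}"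
      by (simp only: topspace_eq_carrier)
    moreover have "{D \<in> topspace Y. coset_dist G d \<phi> X C D < e} \<subseteq> ?p ` topspace T"
      unfolding Y topspace_eq_carrier by blast
    ultimately show "openin Y {D \<in> topspace Y. coset_dist G d \<phi> X C D < e}"
      by (simp only: Y_def coset_topology_def openin_quotient_topology simp_thms)
  next
    fix C D assume "C \<in> topspace Y" "D \<in> topspace Y"
    then show "coset_dist G d \<phi> X C D = coset_dist G d \<phi> X D C"
      unfolding Y by (auto simp: dist hausdorff_dist_commute)
  next
    fix B C D assume "B \<in> topspace Y" "C \<in> topspace Y" "D \<in> topspace Y"
    then show "coset_dist G d \<phi> X B D \<le> coset_dist G d \<phi> X B C + coset_dist G d \<phi> X C D"
      unfolding Y by (auto simp: dist tri)
  next
    fix C assume "C \<in> topspace Y"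
    then show "coset_dist G d \<phi> X C C = 0"
      unfolding Y by (auto simp: dist refl)
  qed
qed

end

theorem proposition4p1:
  fixes G :: "('a, 'm) monoid_scheme" and T :: "'a topology"
    and M :: "'b set" and d :: "'b \<Rightarrow> 'b \<Rightarrow> real"
    and \<phi> :: "'a \<Rightarrow> 'b \<Rightarrow> 'b" and X :: "'b set"
  assumes "continuous_group_action G T M d \<phi>"
    and "compactin (Metric_space.mtopology M d) X" and "X \<noteq> {}"
  shows "continuous_map
    (prod_topology (coset_topology G T (isotropy G \<phi> X)) (coset_topology G T (isotropy G \<phi> X)))
    euclideanreal
    (\<lambda>(C, D). coset_dist G d \<phi> X C D)"
  using assms by (rule continuous_group_action.continuous_map_coset_dist)

end
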